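(* Let $n\geq 2$ be an integer and let $\alpha=(\alpha_{1},\dots,\alpha_{n})$ be an $n$-tuple of negative real numbers such that $1,\alpha_{1},\dots,\alpha_{n}$ are linearly independent over $\mathbb{Q}$. Set $$A_{\alpha}=\mathbb{N}^{n}+\mathbb{N}[\alpha_{1},\dots,\alpha_{n}]^{T}=\left\{[s_{1},\dots,s_{n}]^{T}+s[\alpha_{1},\dots,\alpha_{n}]^{T}:\ s,s_{1},\dots,s_{n}\in\mathbb{N}\right\}\subset\mathbb{R}^{n}.$$ Then $A_{\alpha}$ is dense in $\mathbb{R}^{n}$, and for every nontrivial (real) linear subspace $M$ of $\mathbb{R}^{n}$, the set $A_{\alpha}\cap M$ is not dense in $M$.
   Context: $\mathbb{N}$ denotes the set of non-negative integers (including $0$). $v^{T}$ denotes the transpose of a row vector $v$. A subspace $M$ of a vector space $X$ is called nontrivial if $M\neq\{0\}$ and $M\neq X$. Density is with respect to the usual topology of $\mathbb{R}^{n}$ (and, for $M$, the induced topology). *)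

theory Defs
  imports "HOL-Analysis.Analysis"
begin

text \<open>Linear independence over the rationals of an indexed family of reals. The library notion of
  independence is about sets, so injectivity is needed to exclude repeated members of the family.\<close>

definition rat_independent_family :: "('i \<Rightarrow> real) \<Rightarrow> bool" where
  "rat_independent_family f \<longleftrightarrow>
     inj f \<and> module.independent (\<lambda>(q::rat) (x::real). of_rat q * x) (range f)"

interpretation rat_real: vector_space "\<lambda>(q::rat) (x::real). of_rat q * x"
  by unfold_locales (auto simp: algebra_simps of_rat_add of_rat_mult)

lemma rat_independent_family_iff:
  fixes f :: "'i::finite \<Rightarrow> real"
  shows "rat_independent_family f \<longleftrightarrow>
     (\<forall>c :: 'i \<Rightarrow> rat. (\<Sum>i\<in>UNIV. of_rat (c i) * f i) = 0 \<longrightarrow> (\<forall>i. c i = 0))"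
proof (intro iffI allI impI)
  fix c :: "'i \<Rightarrow> rat" and i
  assume ind: "rat_independent_family f" and 0: "(\<Sum>i\<in>UNIV. of_rat (c i) * f i) = 0"
  then have inj: "inj f" by (simp add: rat_independent_family_def)
  have "(\<Sum>v\<in>range f. of_rat (c (inv f v)) * v) = 0"
    using 0 by (simp add: sum.reindex[OF inj] inj)
  with ind have "c (inv f (f i)) = 0"
    unfolding rat_independent_family_def
    using rat_real.independentD[of "range f" "range f" "\<lambda>v. c (inv f v)" "f i"] by auto
  then show "c i = 0" by (simp add: inj)
next
  assume H: "\<forall>c :: 'i \<Rightarrow> rat. (\<Sum>i\<in>UNIV. of_rat (c i) * f i) = 0 \<longrightarrow> (\<forall>i. c i = 0)"
  have inj: "inj f"
  proof (rule injI, rule ccontr)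
    fix i j assume e: "f i = f j" and ne: "i \<noteq> j"
    define c :: "'i \<Rightarrow> rat" where "c = (\<lambda>k. (if k = i then 1 else 0) - (if k = j then 1 else 0))"
    have "(\<Sum>k\<in>UNIV. of_rat (c k) * f k) =
        (\<Sum>k\<in>UNIV. (if k = i then f k else 0) - (if k = j then f k else 0))"
      by (rule sum.cong) (auto simp: c_def of_rat_diff)
    also have "\<dots> = 0" using e by (simp add: sum_subtractf)
    finally have "c i = 0" using H by blast
    then show False using ne by (simp add: c_def)
  qed
  have "rat_real.independent (range f)"
  proof
    assume "rat_real.dependent (range f)"
    then obtain u v where v: "v \<in> range f" "u v \<noteq> 0"
        and "(\<Sum>v\<in>range f. of_rat (u v) * v) = 0"
      by (auto simp: rat_real.dependent_finite)
    then have "(\<Sum>i\<in>UNIV. of_rat (u (f i)) * f i) = 0"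
      by (simp add: sum.reindex[OF inj])
    with H have "\<forall>i. u (f i) = 0" by (elim allE[of _ "\<lambda>i. u (f i)"]) auto
    with v show False by auto
  qed
  with inj show "rat_independent_family f" by (simp add: rat_independent_family_def)
qed

definition A_set :: "real ^ 'n \<Rightarrow> (real ^ 'n) set" where
  "A_set \<alpha> = {(\<chi> i. real (s i)) + real t *\<^sub>R \<alpha> | (s :: 'n \<Rightarrow> nat) (t :: nat). True}"

end

theory Submission
  imports Defs
begin

text \<open>
  Density is Kronecker's theorem, with a simultaneous Dirichlet approximation used to make the
  multiplier of \<open>\<alpha>\<close> so large that the integer parts have the required sign.

  For a proper subspace \<open>M\<close> pick \<open>v \<noteq> 0\<close> orthogonal to \<open>M\<close> and a \<open>\<rat>\<close>-linear functional
  \<open>\<phi> : \<real> \<rightarrow> \<rat>\<close> not vanishing at some coordinate of \<open>v\<close>, and put \<open>c\<^sub>i = \<phi> (v\<^sub>i)\<close>. If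
  \<open>x = s + t \<alpha>\<close> lies in \<open>M\<close>, applying \<open>\<phi>\<close> to \<open>v \<bullet> x = 0\<close> yields \<open>c \<bullet> x = t \<kappa>\<close>, where
  \<open>\<kappa> = c \<bullet> \<alpha> - \<phi> (v \<bullet> \<alpha>)\<close> is nonzero by independence. Thus \<open>c \<bullet> x\<close> has constant sign on
  \<open>A\<^sub>\<alpha> \<inter> M\<close>. If this set were dense in \<open>M\<close>, the form would vanish on \<open>M\<close>, hence always
  \<open>t = 0\<close>, and \<open>M\<close> would lie in the nonnegative orthant.
\<close>

text \<open>Bridges to \<open>Kronecker_thm_2\<close>, whose independence hypothesis is over the
  integers: an integer relation is in particular a rational one.\<close>

lemma int_independent_if_rat_independent:
  assumes "rat_real.independent S"
  shows "module.independent (\<lambda>r x. real_of_int r * x) S"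
proof -
  interpret int_real: Modules.module "\<lambda>r. (*) (real_of_int r)"
    by (simp add: Modules.module.intro distrib_left mult.commute)
  show ?thesis
  proof
    assume "int_real.dependent S"
    then obtain T u v where T: "finite T" "T \<subseteq> S" "v \<in> T" "u v \<noteq> 0"
      and "(\<Sum>v\<in>T. real_of_int (u v) * v) = 0"
      unfolding int_real.dependent_explicit by blast
    then have "(\<Sum>v\<in>T. of_rat (of_int (u v)) * v) = 0"
      by simp
    from rat_real.independentD[OF assms T(1,2) this T(3)] T(4) show False
      by simp
  qed
qed

text \<open>Dirichlet's theorem by itself gives a positive multiplier \<open>q\<close>. Applied to
  the numbers \<open>L * \<theta> i\<close> with \<open>L = max 1 K\<close>, it makes
  \<open>q * L\<close> a multiplier of the \<open>\<theta> i\<close> that is at least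
  \<open>K\<close>.\<close>

lemma Dirichlet_approx_simult_large:
  fixes \<theta> :: "nat \<Rightarrow> real"
  assumes "\<epsilon> > 0"
  obtains q p where "q \<ge> K" "\<And>i. i < n \<Longrightarrow> \<bar>of_int q * \<theta> i - of_int (p i)\<bar> < \<epsilon>"
proof -
  obtain N :: nat where N: "N > 0" "1 / N < \<epsilon>"
    by (metis \<open>\<epsilon> > 0\<close> gr_zeroI inverse_eq_divide real_arch_inverse)
  define L where "L = max 1 K"
  obtain q p where q: "0 < q"
    and qp: "\<And>i. i < n \<Longrightarrow> \<bar>of_int q * (of_int L * \<theta> i) - of_int (p i)\<bar> < 1 / N"
    using Dirichlet_approx_simult[OF N(1), of n "\<lambda>i. of_int L * \<theta> i"] by metis
  have "1 * L \<le> q * L"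
    using q by (intro mult_right_mono) (auto simp: L_def)
  then have "q * L \<ge> K"
    by (simp add: L_def)
  moreover have "\<bar>of_int (q * L) * \<theta> i - of_int (p i)\<bar> < \<epsilon>" if "i < n" for i
    using qp[OF that] N(2) by (simp add: mult.assoc)
  ultimately show ?thesis
    using that by blast
qed

text \<open>Adding to a Kronecker multiplier \<open>k\<close> a Dirichlet multiplier
  \<open>q \<ge> K - k\<close> moves every coordinate by almost an integer. The sum is large and
  still approximates \<open>x\<close>, each summand contributing an error below
  \<open>\<epsilon> / 2\<close>.\<close>

lemma Kronecker_large:
  fixes \<alpha> x :: "real ^ 'n"
  assumes indep: "rat_independent_family (case_option 1 (\<lambda>i. \<alpha> $ i))" and "\<epsilon> > 0"
  obtains k m where "k \<ge> K" "\<And>i. \<bar>of_int k * \<alpha> $ i - of_int (m i) - x $ i\<bar> < \<epsilon>"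
proof -
  define n where "n = CARD('n)"
  obtain h :: "nat \<Rightarrow> 'n" where h: "bij_betw h {..<n} UNIV"
    using ex_bij_betw_nat_finite[of "UNIV :: 'n set"] by (auto simp: n_def lessThan_atLeast0)
  define g where "g = inv_into {..<n} h"
  have g: "g i < n" "h (g i) = i" for i
    using bij_betwE[OF bij_betw_inv_into[OF h]] bij_betw_inv_into_right[OF h]
    by (auto simp: g_def)
  define f where "f = case_option 1 (\<lambda>i. \<alpha> $ i)"
  \<comment> \<open>\<open>Kronecker_thm_2\<close> takes a family indexed by \<open>{..n}\<close>
    whose last member is 1, so \<open>None\<close> gets the index \<open>n\<close>.\<close>
  define e where "e j = (if j = n then None else Some (h j))" for j
  have inj_e: "inj_on e {..n}"
    using bij_betw_imp_inj_on[OF h] by (auto simp: inj_on_def e_def)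
  define \<theta> where "\<theta> = f \<circ> e"
  have inj_f: "inj f" and ind_f: "rat_real.independent (range f)"
    using indep by (simp_all add: rat_independent_family_def f_def)
  have "rat_real.independent (\<theta> ` {..n})"
    by (rule rat_real.independent_mono[OF ind_f]) (auto simp: \<theta>_def)
  then have ind: "module.independent (\<lambda>r x. real_of_int r * x) (\<theta> ` {..n})"
    by (rule int_independent_if_rat_independent)
  have inj: "inj_on \<theta> {..n}"
    unfolding \<theta>_def by (rule comp_inj_on[OF inj_e inj_on_subset[OF inj_f]]) simp
  have \<theta>n: "\<theta> n = 1" and \<theta>g: "\<theta> (g i) = \<alpha> $ i" for i
    using g[of i] by (auto simp: \<theta>_def e_def f_def)
  obtain k m where km: "\<And>i. i < n \<Longrightarrow> \<bar>of_int k * \<theta> i - of_int (m i) - x $ h i\<bar> < \<epsilon> / 2"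
    using Kronecker_thm_2[OF ind inj \<theta>n, of "\<epsilon> / 2" "\<lambda>i. x $ h i"] \<open>\<epsilon> > 0\<close> by auto
  obtain q p where q: "q \<ge> K - k"
    and qp: "\<And>i. i < n \<Longrightarrow> \<bar>of_int q * \<theta> i - of_int (p i)\<bar> < \<epsilon> / 2"
    using Dirichlet_approx_simult_large[of "\<epsilon> / 2" "K - k" n \<theta>] \<open>\<epsilon> > 0\<close> by auto
  show ?thesis
  proof
    show "k + q \<ge> K"
      using q by simp
    show "\<bar>of_int (k + q) * \<alpha> $ i - of_int (m (g i) + p (g i)) - x $ i\<bar> < \<epsilon>" for i
      using km[OF g(1)[of i]] qp[OF g(1)[of i]]
      by (simp add: \<theta>g g(2) distrib_right) (smt (verit) field_sum_of_halves)
  qed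
qed

lemma closure_A_set:
  fixes \<alpha> :: "real ^ 'n"
  assumes neg: "\<And>i. \<alpha> $ i < 0"
    and indep: "rat_independent_family (case_option 1 (\<lambda>i. \<alpha> $ i))"
  shows "closure (A_set \<alpha>) = UNIV"
proof -
  have "\<exists>y\<in>A_set \<alpha>. dist y x < \<epsilon>" if "\<epsilon> > 0" for x :: "real ^ 'n" and \<epsilon>
  proof -
    \<comment> \<open>The norm is at most the sum of the \<open>CARD('n)\<close> coordinate errors,
      hence at most \<open>\<epsilon> / 2\<close>.\<close>
    define \<delta> where "\<delta> = \<epsilon> / (2 * real CARD('n))"
    have "\<delta> > 0"
      using \<open>\<epsilon> > 0\<close> by (simp add: \<delta>_def)
    \<comment> \<open>For \<open>k \<ge> B i\<close> one has
      \<open>k * \<alpha> $ i \<le> - \<bar>x $ i\<bar> - \<delta>\<close>, which forces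
      \<open>m i \<le> 0\<close> and makes \<open>- m i\<close> a natural number. The 0 inserted
      into the maximum ensures \<open>k \<ge> 0\<close>.\<close>
    define B where "B i = (\<bar>x $ i\<bar> + \<delta>) / - \<alpha> $ i" for i
    define K where "K = \<lceil>Max (insert 0 (range B))\<rceil>"
    obtain k m where k: "k \<ge> K"
      and km: "\<And>i. \<bar>of_int k * \<alpha> $ i - of_int (m i) - x $ i\<bar> < \<delta>"
      using Kronecker_large[OF indep \<open>\<delta> > 0\<close>, of K x] by metis
    have kB: "real_of_int k \<ge> b" if "b \<in> insert 0 (range B)" for b
      using Max_ge[of "insert 0 (range B)" b] k that unfolding K_def ceiling_le_iff
      by (meson finite_insert finite_imageI finite_class.finite order_trans)
    have "k \<ge> 0"
      using kB[of 0] by simp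
    have m: "m i \<le> 0" for i
    proof -
      have "B i * - \<alpha> $ i \<le> of_int k * - \<alpha> $ i"
        using kB[of "B i"] neg[of i] by (intro mult_right_mono) auto
      moreover have "B i * - \<alpha> $ i = \<bar>x $ i\<bar> + \<delta>"
        using neg[of i] by (simp add: B_def)
      ultimately have "real_of_int (m i) < 1"
        using km[of i] by linarith
      then show ?thesis by simp
    qed
    define y where "y = (\<chi> i. real (nat (- m i))) + real (nat k) *\<^sub>R \<alpha>"
    have "norm (y - x) \<le> (\<Sum>i\<in>UNIV. \<bar>(y - x) $ i\<bar>)"
      by (rule norm_le_l1_cart)
    also have "\<dots> \<le> (\<Sum>i\<in>(UNIV :: 'n set). \<delta>)"
    proof (rule sum_mono)
      fix i :: 'n
      show "\<bar>(y - x) $ i\<bar> \<le> \<delta>"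
        using km[of i] m[of i] \<open>k \<ge> 0\<close> by (simp add: y_def)
    qed
    also have "\<dots> < \<epsilon>"
      using \<open>\<epsilon> > 0\<close> by (simp add: \<delta>_def)
    finally have "dist y x < \<epsilon>"
      by (simp add: dist_norm)
    moreover have "y \<in> A_set \<alpha>"
      unfolding A_set_def y_def by (intro CollectI exI conjI TrueI) (rule refl)
    ultimately show ?thesis by blast
  qed
  then show ?thesis
    by (auto simp: closure_approachable)
qed

text \<open>Extend \<open>{a}\<close> to a basis of the reals over the rationals and take the
  coordinate at \<open>a\<close>.\<close>

lemma ex_rat_linear_functional:
  fixes a :: real
  assumes "a \<noteq> 0"
  obtains \<phi> :: "real \<Rightarrow> rat" where "\<phi> a \<noteq> 0" "\<And>x y. \<phi> (x + y) = \<phi> x + \<phi> y"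
    "\<And>q x. \<phi> (of_rat q * x) = q * \<phi> x"
proof -
  have "rat_real.independent {a}"
    using assms by simp
  define B where "B = rat_real.extend_basis {a}"
  have B: "rat_real.independent B" "x \<in> rat_real.span B" "a \<in> B" for x
    using rat_real.independent_extend_basis[OF \<open>rat_real.independent {a}\<close>]
      rat_real.span_extend_basis[OF \<open>rat_real.independent {a}\<close>]
      rat_real.extend_basis_superset[OF \<open>rat_real.independent {a}\<close>]
    by (auto simp: B_def)
  show ?thesis
    by (rule that[of "\<lambda>x. rat_real.representation B x a"])
      (simp_all add: B rat_real.representation_add rat_real.representation_scale
        rat_real.representation_basis)
qed

lemma not_dense_in_proper_subspace:
  fixes \<alpha> :: "real ^ 'n" and M :: "(real ^ 'n) set"
  assumes indep: "rat_independent_family (case_option 1 (\<lambda>i. \<alpha> $ i))"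
    and M: "subspace M" "M \<noteq> {0}" "M \<noteq> UNIV"
  shows "\<not> M \<subseteq> closure (A_set \<alpha> \<inter> M)"
proof
  assume dense: "M \<subseteq> closure (A_set \<alpha> \<inter> M)"
  have "span M \<subset> span UNIV"
    using M by (auto simp: span_eq_iff[THEN iffD2])
  then obtain v where "v \<noteq> 0" and v: "\<And>y. y \<in> M \<Longrightarrow> v \<bullet> y = 0"
    by (rule orthogonal_to_subspace_exists_gen) (auto simp: orthogonal_def span_base)
  then obtain j where "v $ j \<noteq> 0"
    by (auto simp: vec_eq_iff)
  then obtain \<phi> :: "real \<Rightarrow> rat" where \<phi>j: "\<phi> (v $ j) \<noteq> 0"
    and \<phi>_add: "\<And>x y. \<phi> (x + y) = \<phi> x + \<phi> y"
    and \<phi>_scale: "\<And>q x. \<phi> (of_rat q * x) = q * \<phi> x"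
    by (rule ex_rat_linear_functional) blast
  have \<phi>_0: "\<phi> 0 = 0"
    using \<phi>_add[of 0 0] by simp
  have \<phi>_sum: "\<phi> (sum f S) = (\<Sum>i\<in>S. \<phi> (f i))" for f and S :: "'n set"
    by (induction S rule: infinite_finite_induct) (simp_all add: \<phi>_0 \<phi>_add)
  have \<phi>_nat: "\<phi> (real t * x) = of_nat t * \<phi> x" for t x
    using \<phi>_scale[of "of_nat t" x] by simp
  define c :: "real ^ 'n" where "c = (\<chi> i. of_rat (\<phi> (v $ i)))"
  define \<kappa> where "\<kappa> = c \<bullet> \<alpha> - of_rat (\<phi> (v \<bullet> \<alpha>))"
  \<comment> \<open>\<open>\<kappa>\<close> is a rational combination of 1 and the
    \<open>\<alpha> $ i\<close> in which \<open>\<alpha> $ j\<close> has the nonzero coefficient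
    \<open>\<phi> (v $ j)\<close>.\<close>
  have "\<kappa> \<noteq> 0"
  proof
    assume "\<kappa> = 0"
    define d where "d = case_option (- \<phi> (v \<bullet> \<alpha>)) (\<lambda>i. \<phi> (v $ i))"
    have "(\<Sum>i\<in>UNIV. of_rat (d i) * (case i of None \<Rightarrow> 1 | Some i \<Rightarrow> \<alpha> $ i)) = \<kappa>"
      by (simp add: UNIV_option_conv sum.reindex d_def \<kappa>_def c_def inner_vec_def of_rat_minus)
    with \<open>\<kappa> = 0\<close> indep have "d (Some j) = 0"
      unfolding rat_independent_family_iff by blast
    with \<phi>j show False
      by (simp add: d_def)
  qed
  have A: "c \<bullet> ((\<chi> i. real (s i)) + real t *\<^sub>R \<alpha>) = real t * \<kappa>"
    if "(\<chi> i. real (s i)) + real t *\<^sub>R \<alpha> \<in> M" for s t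
  proof -
    have "(\<Sum>i\<in>UNIV. real (s i) * v $ i) + real t * (v \<bullet> \<alpha>) = 0"
      using v[OF that] by (simp add: inner_add_right) (simp add: inner_vec_def mult.commute)
    then have "\<phi> ((\<Sum>i\<in>UNIV. real (s i) * v $ i) + real t * (v \<bullet> \<alpha>)) = 0"
      by (simp add: \<phi>_0)
    \<comment> \<open>Rational scalars pass through \<open>\<phi>\<close>, real ones need not: here
      it matters that \<open>s\<close> and \<open>t\<close> take natural values.\<close>
    then have "(\<Sum>i\<in>UNIV. of_nat (s i) * \<phi> (v $ i)) + of_nat t * \<phi> (v \<bullet> \<alpha>) = 0"
      by (simp add: \<phi>_add \<phi>_sum \<phi>_nat)
    then have "real_of_rat ((\<Sum>i\<in>UNIV. of_nat (s i) * \<phi> (v $ i)) + of_nat t * \<phi> (v \<bullet> \<alpha>)) = 0"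
      by simp
    then have "c \<bullet> (\<chi> i. real (s i)) = - real t * of_rat (\<phi> (v \<bullet> \<alpha>))"
      by (simp add: of_rat_add of_rat_mult of_rat_sum c_def inner_vec_def mult.commute)
    then show ?thesis
      by (simp add: \<kappa>_def inner_add_right algebra_simps)
  qed
  \<comment> \<open>The factor \<open>\<kappa>\<close> turns \<open>t * \<kappa>\<close> into a
    nonnegative multiple of a square, which avoids a case split on the sign of
    \<open>\<kappa>\<close>.\<close>
  have "closed {x. 0 \<le> \<kappa> * (c \<bullet> x)}"
    by (intro closed_Collect_le continuous_intros)
  moreover have "A_set \<alpha> \<inter> M \<subseteq> {x. 0 \<le> \<kappa> * (c \<bullet> x)}"
  proof
    fix x assume x: "x \<in> A_set \<alpha> \<inter> M"
    then obtain s t where st: "x = (\<chi> i. real (s i)) + real t *\<^sub>R \<alpha>"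
      by (auto simp: A_set_def)
    then have "c \<bullet> x = real t * \<kappa>"
      using A[of s t] x by simp
    then show "x \<in> {x. 0 \<le> \<kappa> * (c \<bullet> x)}"
      by (simp add: mult.left_commute[of \<kappa> "real t"])
  qed
  ultimately have "closure (A_set \<alpha> \<inter> M) \<subseteq> {x. 0 \<le> \<kappa> * (c \<bullet> x)}"
    by (intro closure_minimal)
  with dense have nonneg: "0 \<le> \<kappa> * (c \<bullet> x)" if "x \<in> M" for x
    using that by blast
  \<comment> \<open>The inequality holds for \<open>x\<close> and for \<open>- x\<close>, since
    \<open>M\<close> is a subspace.\<close>
  have zero: "c \<bullet> x = 0" if "x \<in> M" for x
    using nonneg[OF that] nonneg[of "- x"] subspace_neg[OF M(1) that] \<open>\<kappa> \<noteq> 0\<close>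
    by (simp add: order_antisym)
  \<comment> \<open>From \<open>t * \<kappa> = 0\<close> follows \<open>t = 0\<close>, so only the
    vector \<open>s\<close> of natural numbers remains.\<close>
  have "A_set \<alpha> \<inter> M \<subseteq> {x. \<forall>i. 0 \<le> x $ i}"
  proof
    fix x assume x: "x \<in> A_set \<alpha> \<inter> M"
    then obtain s t where st: "x = (\<chi> i. real (s i)) + real t *\<^sub>R \<alpha>"
      by (auto simp: A_set_def)
    then have "real t * \<kappa> = 0"
      using A[of s t] zero[of x] x by simp
    then show "x \<in> {x. \<forall>i. 0 \<le> x $ i}"
      using \<open>\<kappa> \<noteq> 0\<close> by (simp add: st)
  qed
  moreover have "closed {x :: real ^ 'n. \<forall>i. 0 \<le> x $ i}"
    by (intro closed_Collect_all closed_Collect_le continuous_intros)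
  ultimately have "closure (A_set \<alpha> \<inter> M) \<subseteq> {x. \<forall>i. 0 \<le> x $ i}"
    by (intro closure_minimal)
  with dense have orthant: "0 \<le> x $ i" if "x \<in> M" for x i
    using that by blast
  have "x = 0" if "x \<in> M" for x
    using orthant[OF that] orthant[OF subspace_neg[OF M(1) that]]
    by (simp add: vec_eq_iff order_antisym)
  then show False
    using M(2) subspace_0[OF M(1)] by auto
qed

theorem theorem2p1:
  fixes \<alpha> :: "real ^ 'n"
  assumes "CARD('n) \<ge> 2"
    and "\<And>i. \<alpha> $ i < 0"
    and "rat_independent_family (case_option 1 (\<lambda>i. \<alpha> $ i))"
  shows "closure (A_set \<alpha>) = UNIV \<and>
    (\<forall>M :: (real ^ 'n) set. subspace M \<and> M \<noteq> {0} \<and> M \<noteq> UNIV \<longrightarrow>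
      (top_of_set M) closure_of (A_set \<alpha> \<inter> M) \<noteq> M)"
proof (intro conjI allI impI notI)
  show "closure (A_set \<alpha>) = UNIV"
    using assms(2,3) by (rule closure_A_set)
next
  fix M :: "(real ^ 'n) set"
  assume M: "subspace M \<and> M \<noteq> {0} \<and> M \<noteq> UNIV"
    and dense: "(top_of_set M) closure_of (A_set \<alpha> \<inter> M) = M"
  \<comment> \<open>Density relative to \<open>M\<close> is carried over to the closure in the whole
    space.\<close>
  have "(top_of_set M) closure_of (A_set \<alpha> \<inter> M) \<subseteq> closure (A_set \<alpha> \<inter> M)"
    using closure_of_subtopology_subset[of euclidean M "A_set \<alpha> \<inter> M"] by simp
  then have "M \<subseteq> closure (A_set \<alpha> \<inter> M)"
    unfolding dense .
  with M show False
    using not_dense_in_proper_subspace[OF assms(3)] by blast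
qed

end
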